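(* No algorithm (possibly adaptive and randomized) can solve the Graph Reconstruction problem with a CC oracle using $o(m)$ CC queries with success probability greater than $1/2$ on every instance; the same holds with $o(m)$ replaced by $o(k^2)$, by $o(\Delta^2)$, or by $o(d^2)$, where $m$, $k$, $\Delta$, $d$ denote the number of edges, the treewidth, the maximum degree and the degeneracy of the hidden graph.
   Context: Graph Reconstruction (GR): an unknown ("hidden") simple undirected graph $G=(V,E)$ on a known vertex set $V$ with $|V|=n$ is to be determined; the algorithm must output $E$. It accesses $G$ only through a connected components (CC) oracle: a query is a set $S\subseteq V$, and the answer is the partition of $S$ into the vertex sets of the connected components of the induced subgraph $G[S]$. Complexity is measured by the number of queries. The degeneracy of a graph is the smallest integer $d$ such that every induced subgraph has a vertex of degree at most $d$. *)

theory Defs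
  imports "HOL-Probability.Probability" "HOL-Library.Landau_Symbols"
begin

section \<open>Simple graphs and their parameters\<close>

definition simple_graph :: "'v set \<Rightarrow> 'v set set \<Rightarrow> bool" where
  "simple_graph V E \<longleftrightarrow> finite V \<and> (\<forall>e\<in>E. e \<subseteq> V \<and> card e = 2)"

definition adj :: "'v set set \<Rightarrow> 'v rel" where
  "adj E = {(u, v). {u, v} \<in> E}"

definition induced_edges :: "'v set set \<Rightarrow> 'v set \<Rightarrow> 'v set set" where
  "induced_edges E S = {e \<in> E. e \<subseteq> S}"

definition linked_in :: "'v set set \<Rightarrow> 'v set \<Rightarrow> 'v rel" where
  "linked_in E S = {(u, v). u \<in> S \<and> v \<in> S \<and> (u, v) \<in> (adj (induced_edges E S))\<^sup>*}"

text \<open>The partition of \<open>S\<close> into the vertex sets of the connected components of the subgraph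
  induced by \<open>S\<close>; this is the answer of the CC oracle to the query \<open>S\<close>.\<close>

definition cc :: "'v set set \<Rightarrow> 'v set \<Rightarrow> 'v set set" where
  "cc E S = S // linked_in E S"

definition connected_in :: "'v set set \<Rightarrow> 'v set \<Rightarrow> bool" where
  "connected_in E S \<longleftrightarrow> S \<noteq> {} \<and> (\<forall>u\<in>S. \<forall>v\<in>S. (u, v) \<in> linked_in E S)"

definition degree :: "'v set set \<Rightarrow> 'v \<Rightarrow> nat" where
  "degree E v = card {e \<in> E. v \<in> e}"

definition num_edges :: "'v set \<Rightarrow> 'v set set \<Rightarrow> nat" where
  "num_edges V E = card E"

text \<open>The inserted \<open>0\<close> only matters for the graph without vertices.\<close>

definition max_degree :: "'v set \<Rightarrow> 'v set set \<Rightarrow> nat" where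
  "max_degree V E = Max (insert 0 (degree E ` V))"

definition degeneracy :: "'v set \<Rightarrow> 'v set set \<Rightarrow> nat" where
  "degeneracy V E =
    (LEAST d. \<forall>S\<subseteq>V. S \<noteq> {} \<longrightarrow> (\<exists>v\<in>S. degree (induced_edges E S) v \<le> d))"

definition is_cycle :: "'v set set \<Rightarrow> 'v list \<Rightarrow> bool" where
  "is_cycle E p \<longleftrightarrow> 3 \<le> length p \<and> distinct p \<and>
    (\<forall>i<length p. {p ! i, p ! (Suc i mod length p)} \<in> E)"

definition is_tree :: "'v set \<Rightarrow> 'v set set \<Rightarrow> bool" where
  "is_tree V E \<longleftrightarrow> simple_graph V E \<and> connected_in E V \<and> (\<nexists>p. is_cycle E p)"

definition tree_decomposition ::
  "'v set \<Rightarrow> 'v set set \<Rightarrow> 't set \<Rightarrow> 't set set \<Rightarrow> ('t \<Rightarrow> 'v set) \<Rightarrow> bool" where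
  "tree_decomposition V E T F B \<longleftrightarrow>
    is_tree T F \<and>
    (\<Union>t\<in>T. B t) = V \<and>
    (\<forall>e\<in>E. \<exists>t\<in>T. e \<subseteq> B t) \<and>
    (\<forall>v\<in>V. connected_in F {t \<in> T. v \<in> B t})"

text \<open>Truncated subtraction only matters for the graph without vertices, whose treewidth is
  \<open>0\<close> here.\<close>

definition td_width :: "'t set \<Rightarrow> ('t \<Rightarrow> 'v set) \<Rightarrow> nat" where
  "td_width T B = Max ((\<lambda>t. card (B t)) ` T) - 1"

text \<open>Trees are finite, so natural numbers suffice as their nodes.\<close>

definition treewidth :: "'v set \<Rightarrow> 'v set set \<Rightarrow> nat" where
  "treewidth V E =
    (LEAST w. \<exists>(T :: nat set) F B. tree_decomposition V E T F B \<and> td_width T B = w)"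


section \<open>Query algorithms\<close>

text \<open>A deterministic adaptive algorithm is a decision tree: it either stops with a claimed edge
  set, or asks a query and continues depending on the answer.\<close>

datatype 'v cc_alg =
    Output "'v set set"
  | Query "'v set" "'v set set \<Rightarrow> 'v cc_alg"

primrec queries_within :: "'v set \<Rightarrow> 'v cc_alg \<Rightarrow> bool" where
  "queries_within V (Output F) \<longleftrightarrow> True"
| "queries_within V (Query S k) \<longleftrightarrow> S \<subseteq> V \<and> (\<forall>P. queries_within V (k P))"

primrec result :: "'v cc_alg \<Rightarrow> ('v set \<Rightarrow> 'v set set) \<Rightarrow> 'v set set" where
  "result (Output F) orc = F"
| "result (Query S k) orc = result (k (orc S)) orc"

primrec num_queries :: "'v cc_alg \<Rightarrow> ('v set \<Rightarrow> 'v set set) \<Rightarrow> nat" where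
  "num_queries (Output F) orc = 0"
| "num_queries (Query S k) orc = Suc (num_queries (k (orc S)) orc)"

text \<open>A randomized algorithm for the known vertex set \<open>{..<n}\<close> draws a random seed \<open>\<omega>\<close> from a
  probability space \<open>M n\<close>, arbitrary for each \<open>n\<close>, and then runs the decision tree \<open>A n \<omega>\<close>.\<close>

definition randomized_alg ::
  "(nat \<Rightarrow> 'w measure) \<Rightarrow> (nat \<Rightarrow> 'w \<Rightarrow> nat cc_alg) \<Rightarrow> bool" where
  "randomized_alg M A \<longleftrightarrow>
    (\<forall>n. prob_space (M n) \<and> (\<forall>\<omega>\<in>space (M n). queries_within {..<n} (A n \<omega>)))"

text \<open>Non-measurable sets have \<open>measure\<close> zero, so the inequality includes that success is an
  event.\<close>

definition reconstructs ::
  "(nat \<Rightarrow> 'w measure) \<Rightarrow> (nat \<Rightarrow> 'w \<Rightarrow> nat cc_alg) \<Rightarrow> bool" where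
  "reconstructs M A \<longleftrightarrow>
    (\<forall>n E. simple_graph {..<n} E \<longrightarrow>
      measure (M n) {\<omega> \<in> space (M n). result (A n \<omega>) (cc E) = E} > 1 / 2)"

text \<open>The number of queries is \<open>o(g(p))\<close>, for a graph parameter \<open>p\<close>, as \<open>p\<close> tends to infinity,
  uniformly over all hidden graphs. Graphs where \<open>p\<close> is small are not constrained. The bound is on
  the worst case over the random seeds, up to a null set.\<close>

definition uses_o_queries ::
  "(nat \<Rightarrow> 'w measure) \<Rightarrow> (nat \<Rightarrow> 'w \<Rightarrow> nat cc_alg) \<Rightarrow>
   (nat set \<Rightarrow> nat set set \<Rightarrow> nat) \<Rightarrow> (nat \<Rightarrow> real) \<Rightarrow> bool" where
  "uses_o_queries M A p g \<longleftrightarrow>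
    (\<exists>f \<in> o(g). \<exists>N. \<forall>n E. simple_graph {..<n} E \<and> N \<le> p {..<n} E \<longrightarrow>
      (AE \<omega> in M n. real (num_queries (A n \<omega>) (cc E)) \<le> f (p {..<n} E)))"

end

theory Submission
  imports Defs
begin

text \<open>The hidden graph consists of two disjoint cliques on \<open>a\<close> vertices each and an arbitrary set of
  edges between them. A query is then answered in one of only two ways: either the cliques are
  linked inside the queried set or they are not. So a decision tree of depth \<open>q\<close> is right on at most
  \<open>2 ^ q\<close> of these \<open>2 ^ a\<^sup>2\<close> graphs, and averaging over the seeds shows that \<open>a\<^sup>2\<close> queries are needed
  for a success probability above one half. All four parameters are at least \<open>a - 1\<close> because of the
  cliques, while \<open>m\<close>, \<open>k\<^sup>2\<close>, \<open>\<Delta>\<^sup>2\<close>, \<open>d\<^sup>2\<close> are at most \<open>(2 a)\<^sup>2\<close>.\<close>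

section \<open>Cliques and graph parameters\<close>

definition clique :: "'v set set \<Rightarrow> 'v set \<Rightarrow> bool" where
  "clique E K \<longleftrightarrow> (\<forall>u\<in>K. \<forall>v\<in>K. u \<noteq> v \<longrightarrow> {u, v} \<in> E)"

lemma simple_graph_finite_edges:
  assumes "simple_graph V E"
  shows "finite E"
  using assms by (auto simp: simple_graph_def intro: finite_subset[of E "Pow V"])

lemma degree_le_card_vertices:
  assumes "simple_graph V E"
  shows "degree E v \<le> card V"
proof -
  have "{e \<in> E. v \<in> e} \<subseteq> (\<lambda>u. {u, v}) ` V"
    using assms by (fastforce simp: simple_graph_def card_2_iff)
  then show ?thesis
    unfolding degree_def using assms
    by (meson card_image_le card_mono finite_imageI le_trans simple_graph_def)
qed

lemma num_edges_le_card_vertices_squared: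
  assumes "simple_graph V E"
  shows "num_edges V E \<le> (card V)\<^sup>2"
proof -
  have fin: "finite V"
    using assms by (simp add: simple_graph_def)
  have "E \<subseteq> (\<lambda>(u, v). {u, v}) ` (V \<times> V)"
    using assms by (fastforce simp: simple_graph_def card_2_iff)
  then have "card E \<le> card (V \<times> V)"
    using fin by (meson card_image_le card_mono finite_SigmaI finite_imageI le_trans)
  then show ?thesis
    by (simp add: num_edges_def power2_eq_square card_cartesian_product)
qed

lemma max_degree_le_card_vertices:
  assumes "simple_graph V E"
  shows "max_degree V E \<le> card V"
  using assms degree_le_card_vertices[OF assms] by (auto simp: max_degree_def simple_graph_def)

text \<open>The remaining vertices of \<open>K\<close> give distinct edges at \<open>v\<close>,
  since \<open>u\<close> can be read off from \<open>{u, v}\<close>.\<close>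

lemma clique_card_le_degree:
  assumes "clique E K" "v \<in> K" "finite E"
  shows "card K - 1 \<le> degree E v"
proof -
  have "card ((\<lambda>u. {u, v}) ` (K - {v})) \<le> degree E v"
    unfolding degree_def using assms by (intro card_mono) (auto simp: clique_def)
  moreover have "inj_on (\<lambda>u. {u, v}) (K - {v})"
    by (auto simp: inj_on_def doubleton_eq_iff)
  ultimately show ?thesis
    using assms by (simp add: card_image card_Diff_singleton)
qed

text \<open>A bound linear in \<open>card K\<close> is enough even for the number of edges: the
  lower bounds serve only to drive the parameters to infinity.\<close>

lemma clique_card_le_num_edges:
  assumes "simple_graph V E" "clique E K"
  shows "card K - 1 \<le> num_edges V E"
proof (cases "K = {}")
  case False
  then obtain v where "v \<in> K" by auto
  then have "card K - 1 \<le> degree E v"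
    using assms clique_card_le_degree simple_graph_finite_edges by metis
  also have "\<dots> \<le> num_edges V E"
    unfolding degree_def num_edges_def
    using simple_graph_finite_edges[OF assms(1)] by (intro card_mono) auto
  finally show ?thesis .
qed auto

lemma clique_card_le_max_degree:
  assumes "simple_graph V E" "clique E K" "K \<subseteq> V"
  shows "card K - 1 \<le> max_degree V E"
proof (cases "K = {}")
  case False
  then obtain v where v: "v \<in> K" by auto
  then have "card K - 1 \<le> degree E v"
    using assms clique_card_le_degree simple_graph_finite_edges by metis
  also have "\<dots> \<le> max_degree V E"
    unfolding max_degree_def using v assms by (intro Max_ge) (auto simp: simple_graph_def)
  finally show ?thesis .
qed auto

lemma simple_graph_induced_edges:
  assumes "simple_graph V E"
  shows "simple_graph V (induced_edges E S)"
  using assms by (auto simp: simple_graph_def induced_edges_def)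

lemma degeneracy_le_card_vertices:
  assumes "simple_graph V E"
  shows "degeneracy V E \<le> card V"
  unfolding degeneracy_def
  by (rule Least_le)
    (use degree_le_card_vertices[OF simple_graph_induced_edges[OF assms]] in blast)

text \<open>The subgraph induced by \<open>K\<close> is complete on \<open>K\<close>, so whichever
  vertex of small degree is chosen for \<open>S = K\<close> already has \<open>card K - 1\<close>
  neighbours there.\<close>

lemma clique_card_le_degeneracy:
  assumes "simple_graph V E" "clique E K" "K \<subseteq> V"
  shows "card K - 1 \<le> degeneracy V E"
proof (cases "K = {}")
  case False
  let ?P = "\<lambda>d. \<forall>S\<subseteq>V. S \<noteq> {} \<longrightarrow> (\<exists>v\<in>S. degree (induced_edges E S) v \<le> d)"
  \<comment> \<open>A \<open>LEAST\<close> value has the defining property only if some value does;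
    \<open>card V\<close> is one.\<close>
  have "?P (card V)"
    using degree_le_card_vertices[OF simple_graph_induced_edges[OF assms(1)]] by blast
  then have "?P (degeneracy V E)"
    unfolding degeneracy_def by (rule LeastI)
  then obtain v where v: "v \<in> K" "degree (induced_edges E K) v \<le> degeneracy V E"
    using False assms(3) by blast
  have "clique (induced_edges E K) K"
    using assms(2) by (auto simp: clique_def induced_edges_def)
  then have "card K - 1 \<le> degree (induced_edges E K) v"
    using v(1) assms(1) clique_card_le_degree simple_graph_finite_edges
      simple_graph_induced_edges by metis
  then show ?thesis
    using v(2) by simp
qed auto

section \<open>Treewidth\<close>

definition path_list :: "'v set set \<Rightarrow> 'v list \<Rightarrow> bool" where
  "path_list E p \<longleftrightarrow> distinct p \<and> (\<forall>i. Suc i < length p \<longrightarrow> {p ! i, p ! Suc i} \<in> E)"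

text \<open>The first vertex of a longest path has no neighbour besides its successor.\<close>

lemma acyclic_imp_leaf:
  assumes fin: "finite T" and ne: "T \<noteq> {}"
    and loopless: "\<forall>e\<in>F. card e = 2" and acyc: "\<nexists>p. is_cycle F p"
  shows "\<exists>l\<in>T. \<exists>q. \<forall>x\<in>T. {l, x} \<in> F \<longrightarrow> x = q"
proof -
  let ?P = "\<lambda>p. path_list F p \<and> set p \<subseteq> T \<and> p \<noteq> []"
  obtain t where "t \<in> T" using ne by auto
  then have ex: "?P [t]" by (simp add: path_list_def)
  have bound: "length p \<le> card T" if "?P p" for p
    using that fin by (metis card_mono distinct_card path_list_def)
  obtain p where p: "?P p" and longest: "\<And>p'. ?P p' \<Longrightarrow> length p' \<le> length p"
    using ex_has_greatest_nat[of ?P "[t]" length "Suc (card T)"] ex bound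
    by (auto simp: less_Suc_eq_le)
  \<comment> \<open>If \<open>p\<close> has a single vertex, \<open>p ! 1\<close> is unspecified,
    but then \<open>p ! 0\<close> has no neighbour in \<open>T\<close> and the claim is
    vacuous.\<close>
  have "x = p ! 1" if x: "x \<in> T" "{p ! 0, x} \<in> F" for x
  proof -
    have "x \<in> set p"
    proof (rule ccontr)
      assume "x \<notin> set p"
      then have "path_list F (x # p)"
        using p x(2)
        by (auto simp: path_list_def nth_Cons insert_commute split: nat.splits)
      then have "length (x # p) \<le> length p"
        using p x(1) by (intro longest) auto
      then show False by simp
    qed
    then obtain j where j: "j < length p" "x = p ! j"
      by (metis in_set_conv_nth)
    have "j \<noteq> 0"
      using loopless x(2) j(2) by (metis card_2_iff doubleton_eq_iff)
    moreover have "\<not> 2 \<le> j"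
    proof
      assume "2 \<le> j"
      \<comment> \<open>The edge between \<open>p ! j\<close> and \<open>p ! 0\<close> closes the
        first \<open>j + 1\<close> vertices, at least three, to a cycle.\<close>
      have "is_cycle F (take (Suc j) p)"
        unfolding is_cycle_def
      proof (intro conjI allI impI)
        show "3 \<le> length (take (Suc j) p)"
          using \<open>2 \<le> j\<close> j(1) by simp
        show "distinct (take (Suc j) p)"
          using p by (simp add: path_list_def)
        fix i assume i: "i < length (take (Suc j) p)"
        have len: "length (take (Suc j) p) = Suc j"
          using j(1) by simp
        show "{take (Suc j) p ! i, take (Suc j) p ! (Suc i mod length (take (Suc j) p))} \<in> F"
        proof (cases "i = j")
          case True
          then show ?thesis
            using x(2) j unfolding len by (simp add: insert_commute)
        next
          case False
          then have "i < j" using i len by simp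
          then show ?thesis
            using p j(1) unfolding len by (simp add: path_list_def)
        qed
      qed
      then show False using acyc by blast
    qed
    ultimately have "j = 1" by simp
    then show ?thesis using j by simp
  qed
  moreover have "p ! 0 \<in> T"
    using p by (metis length_greater_0_conv nth_mem subsetD)
  ultimately show ?thesis by blast
qed

section \<open>Connected vertex sets and their leaves\<close>

text \<open>Reachability along one explicit symmetric relation, ready for induction on
  paths.\<close>

lemma linked_in_iff:
  "(u, v) \<in> linked_in E S \<longleftrightarrow>
    u \<in> S \<and> v \<in> S \<and> (u, v) \<in> {(x, y). x \<in> S \<and> y \<in> S \<and> {x, y} \<in> E}\<^sup>*"
proof -
  have "adj (induced_edges E S) = {(x, y). x \<in> S \<and> y \<in> S \<and> {x, y} \<in> E}"
    by (auto simp: adj_def induced_edges_def)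
  then show ?thesis
    by (simp add: linked_in_def)
qed

lemma connected_in_iff:
  "connected_in F S \<longleftrightarrow>
    S \<noteq> {} \<and> (\<forall>u\<in>S. \<forall>v\<in>S. (u, v) \<in> {(x, y). x \<in> S \<and> y \<in> S \<and> {x, y} \<in> F}\<^sup>*)"
  by (simp add: connected_in_def linked_in_iff)

text \<open>A path from \<open>l\<close> to another element of \<open>S\<close> stays inside
  \<open>S\<close>, and its first step can only lead to \<open>q\<close>.\<close>

lemma connected_in_leaf_neighbour:
  assumes con: "connected_in F S" and leaf: "\<forall>x\<in>S. {l, x} \<in> F \<longrightarrow> x = q"
    and l: "l \<in> S" "S \<noteq> {l}"
  shows "q \<in> S \<and> {l, q} \<in> F"
proof -
  obtain y where "y \<in> S" "y \<noteq> l" using l by blast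
  then have "(l, y) \<in> {(x, y). x \<in> S \<and> y \<in> S \<and> {x, y} \<in> F}\<^sup>*"
    using con l by (auto simp: connected_in_iff)
  then obtain z where "(l, z) \<in> {(x, y). x \<in> S \<and> y \<in> S \<and> {x, y} \<in> F}"
    using \<open>y \<noteq> l\<close> by (auto elim: converse_rtranclE)
  then show ?thesis using leaf by auto
qed

text \<open>A path passes through \<open>l\<close> only by coming from \<open>q\<close> and
  returning to \<open>q\<close>, so such visits can be cut out.\<close>

lemma connected_in_remove_leaf:
  assumes con: "connected_in F S" and leaf: "\<forall>x\<in>S. {l, x} \<in> F \<longrightarrow> x = q"
    and l: "S \<noteq> {l}"
  shows "connected_in F (S - {l})"
proof -
  let ?R = "\<lambda>S. {(x, y). x \<in> S \<and> y \<in> S \<and> {x, y} \<in> F}"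
  have S: "S \<noteq> {}" using con by (simp add: connected_in_iff)
  have "(u, v) \<in> (?R (S - {l}))\<^sup>*" if u: "u \<in> S - {l}" and v: "v \<in> S - {l}" for u v
  proof -
    have "(u, v) \<in> (?R S)\<^sup>*"
      using con u v by (auto simp: connected_in_iff)
    \<comment> \<open>The induction also meets initial segments ending in \<open>l\<close>; for
      these the endpoint is moved back to \<open>q\<close>.\<close>
    then have "(u, if v = l then q else v) \<in> (?R (S - {l}))\<^sup>*"
    proof (induction rule: rtrancl_induct)
      case base
      then show ?case using u by auto
    next
      case (step y z)
      then have yz: "y \<in> S" "z \<in> S" "{y, z} \<in> F" "{z, y} \<in> F"
        by (auto simp: insert_commute)
      show ?case
      proof (cases "y = l \<or> z = l")
        \<comment> \<open>A step between \<open>l\<close> and \<open>q\<close> leaves the adjusted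
          endpoint at \<open>q\<close>.\<close>
        case True
        then show ?thesis
          using step.IH leaf yz by (auto split: if_splits)
      next
        case False
        then have "(y, z) \<in> ?R (S - {l})" using yz by auto
        then show ?thesis
          using step.IH False by (auto intro: rtrancl_into_rtrancl)
      qed
    qed
    then show ?thesis using v by auto
  qed
  then show ?thesis
    using S l unfolding connected_in_iff by blast
qed

text \<open>If one of the sets is \<open>{l}\<close> for a leaf \<open>l\<close>, then \<open>l\<close> is a common element. Otherwise \<open>l\<close> can be
  deleted: two sets meeting in \<open>l\<close> also contain the neighbour of \<open>l\<close>.\<close>

lemma helly_subtrees:
  assumes "finite T" "\<forall>e\<in>F. card e = 2" "\<nexists>p. is_cycle F p"
    and "\<forall>i\<in>I. S i \<subseteq> T \<and> connected_in F (S i)"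
    and "\<forall>i\<in>I. \<forall>j\<in>I. S i \<inter> S j \<noteq> {}"
    and "I \<noteq> {}"
  shows "\<exists>t\<in>T. \<forall>i\<in>I. t \<in> S i"
  using assms(1,4,5)
\<comment> \<open>The edge set \<open>F\<close> stays fixed while \<open>T\<close> shrinks. Leaves
  are taken relative to \<open>T\<close>, so edges to deleted vertices do no harm.\<close>
proof (induction "card T" arbitrary: T S rule: less_induct)
  case less
  have "T \<noteq> {}"
    using less.prems(2,3) assms(6) by blast
  then obtain l q where l: "l \<in> T" and leaf: "\<forall>x\<in>T. {l, x} \<in> F \<longrightarrow> x = q"
    using acyclic_imp_leaf[OF less.prems(1) _ assms(2,3)] by blast
  show ?case
  proof (cases "\<exists>i\<in>I. S i = {l}")
    case True
    then obtain i where "i \<in> I" "S i = {l}" by blast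
    then have "l \<in> S j" if "j \<in> I" for j
      using less.prems(3) that by fastforce
    then show ?thesis using l by blast
  next
    case False
    have leaf': "\<forall>x\<in>S i. {l, x} \<in> F \<longrightarrow> x = q" if "i \<in> I" for i
      using that leaf less.prems(2) by blast
    have nbr: "q \<in> S i \<and> {l, q} \<in> F" if "i \<in> I" "l \<in> S i" for i
      using connected_in_leaf_neighbour[OF _ leaf'[OF that(1)]] that less.prems(2) False by blast
    have "\<exists>t\<in>T - {l}. \<forall>i\<in>I. t \<in> S i - {l}"
    proof (rule less.hyps)
      show "card (T - {l}) < card T"
        using l less.prems(1) by (intro card_Diff1_less)
      show "finite (T - {l})" using less.prems(1) by simp
      show "\<forall>i\<in>I. S i - {l} \<subseteq> T - {l} \<and> connected_in F (S i - {l})"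
        using connected_in_remove_leaf[OF _ leaf'] less.prems(2) False by blast
      show "\<forall>i\<in>I. \<forall>j\<in>I. (S i - {l}) \<inter> (S j - {l}) \<noteq> {}"
      proof (intro ballI)
        fix i j assume ij: "i \<in> I" "j \<in> I"
        then obtain t where t: "t \<in> S i" "t \<in> S j" using less.prems(3) by blast
        show "(S i - {l}) \<inter> (S j - {l}) \<noteq> {}"
        proof (cases "t = l")
          case True
          then have q: "q \<in> S i" "q \<in> S j" "{l, q} \<in> F"
            using nbr ij t by auto
          then have "q \<noteq> l" using assms(2) by (metis card_2_iff doubleton_eq_iff)
          then show ?thesis using q by blast
        qed (use t in blast)
      qed
    qed
    then show ?thesis by blast
  qed
qed

section \<open>Cliques in tree decompositions\<close>

text \<open>The nodes whose bags contain a fixed vertex form a subtree, and adjacent vertices share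
  a bag, so the subtrees of the clique vertices meet pairwise. By the Helly property they have a
  common node.\<close>

lemma tree_decomposition_clique_in_bag:
  assumes td: "tree_decomposition V E T F B" and K: "clique E K" "K \<subseteq> V" "K \<noteq> {}"
  shows "\<exists>t\<in>T. K \<subseteq> B t"
proof -
  have "\<exists>t\<in>T. \<forall>v\<in>K. t \<in> {t \<in> T. v \<in> B t}"
  proof (rule helly_subtrees)
    show "finite T" "\<forall>e\<in>F. card e = 2" "\<nexists>p. is_cycle F p"
      using td by (auto simp: tree_decomposition_def is_tree_def simple_graph_def)
    show "\<forall>v\<in>K. {t \<in> T. v \<in> B t} \<subseteq> T \<and> connected_in F {t \<in> T. v \<in> B t}"
      using td K by (auto simp: tree_decomposition_def)
    show "\<forall>u\<in>K. \<forall>v\<in>K. {t \<in> T. u \<in> B t} \<inter> {t \<in> T. v \<in> B t} \<noteq> {}"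
    proof (intro ballI)
      fix u v assume uv: "u \<in> K" "v \<in> K"
      have "\<exists>t\<in>T. {u, v} \<subseteq> B t"
      proof (cases "u = v")
        case True
        then show ?thesis
          using td uv K(2) by (auto simp: tree_decomposition_def)
      next
        case False
        then have "{u, v} \<in> E" using uv K(1) by (auto simp: clique_def)
        then show ?thesis using td unfolding tree_decomposition_def by blast
      qed
      then show "{t \<in> T. u \<in> B t} \<inter> {t \<in> T. v \<in> B t} \<noteq> {}" by blast
    qed
  qed (fact K(3))
  then show ?thesis by blast
qed

text \<open>This bounds the treewidth from above and shows that its minimum ranges over a nonempty
  set of widths.\<close>

lemma tree_decomposition_single_bag:
  assumes "simple_graph V E"
  shows "tree_decomposition V E {0 :: nat} {} (\<lambda>_. V)"
proof -
  have "\<not> is_cycle {} p" for p :: "nat list"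
    by (auto simp: is_cycle_def intro: exI[of _ 0])
  moreover have con: "connected_in {} {0 :: nat}"
    by (simp add: connected_in_def linked_in_def)
  ultimately have "is_tree {0 :: nat} {}"
    by (simp add: is_tree_def simple_graph_def)
  moreover have "\<forall>v\<in>V. connected_in {} {t \<in> {0 :: nat}. v \<in> V}"
    using con by simp
  ultimately show ?thesis
    using assms unfolding tree_decomposition_def by (simp add: simple_graph_def)
qed

lemma treewidth_le_card_vertices:
  assumes "simple_graph V E"
  shows "treewidth V E \<le> card V"
proof -
  have "treewidth V E \<le> td_width {0 :: nat} (\<lambda>_. V)"
    unfolding treewidth_def using tree_decomposition_single_bag[OF assms] by (intro Least_le) blast
  then show ?thesis by (simp add: td_width_def)
qed

lemma clique_card_le_treewidth:
  assumes "simple_graph V E" "clique E K" "K \<subseteq> V"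
  shows "card K - 1 \<le> treewidth V E"
proof (cases "K = {}")
  case False
  let ?P = "\<lambda>w. \<exists>(T :: nat set) F B. tree_decomposition V E T F B \<and> td_width T B = w"
  have "?P (td_width {0 :: nat} (\<lambda>_. V))"
    using tree_decomposition_single_bag[OF assms(1)] by blast
  then have "?P (treewidth V E)"
    unfolding treewidth_def by (rule LeastI)
  then obtain T :: "nat set" and F B
    where td: "tree_decomposition V E T F B" and w: "td_width T B = treewidth V E"
    by blast
  obtain t where t: "t \<in> T" "K \<subseteq> B t"
    using tree_decomposition_clique_in_bag[OF td assms(2,3) False] by blast
  have fin: "finite T" "finite (B t)"
    using td t(1) assms(1)
    by (auto simp: tree_decomposition_def is_tree_def simple_graph_def intro: finite_subset)
  have "card K \<le> card (B t)"
    using fin t by (simp add: card_mono)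
  also have "\<dots> \<le> Max ((\<lambda>t. card (B t)) ` T)"
    using fin t by simp
  finally show ?thesis
    using w by (simp add: td_width_def)
qed auto

section \<open>Pairs of cliques\<close>

definition clique_edges :: "nat \<Rightarrow> nat set set" where
  "clique_edges a = {e. card e = 2 \<and> (e \<subseteq> {..<a} \<or> e \<subseteq> {a..<2 * a})}"

definition cross_edges :: "nat \<Rightarrow> nat set set" where
  "cross_edges a = (\<lambda>(u, v). {u, v}) ` ({..<a} \<times> {a..<2 * a})"

definition clique_pairs :: "nat \<Rightarrow> nat set set set" where
  "clique_pairs a = (\<lambda>X. clique_edges a \<union> X) ` Pow (cross_edges a)"

lemma finite_clique_pairs: "finite (clique_pairs a)"
  by (simp add: clique_pairs_def cross_edges_def)

text \<open>There are \<open>a\<^sup>2\<close> cross edges, each chosen freely, and the choice can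
  be recovered from the graph because cross edges are never clique edges.\<close>

lemma card_clique_pairs: "card (clique_pairs a) = 2 ^ a\<^sup>2"
proof -
  have "inj_on (\<lambda>(u, v). {u, v}) ({..<a} \<times> {a..<2 * a})"
    by (auto simp: inj_on_def doubleton_eq_iff)
  then have "card (cross_edges a) = a\<^sup>2"
    by (simp add: cross_edges_def card_image power2_eq_square)
  moreover have "clique_edges a \<inter> cross_edges a = {}"
    by (auto simp: clique_edges_def cross_edges_def)
  then have "inj_on (\<lambda>X. clique_edges a \<union> X) (Pow (cross_edges a))"
    by (intro inj_onI) blast
  moreover have "finite (cross_edges a)"
    by (simp add: cross_edges_def)
  ultimately show ?thesis
    by (simp add: clique_pairs_def card_image card_Pow)
qed

lemma clique_pairs_simple_graph:
  assumes "E \<in> clique_pairs a"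
  shows "simple_graph {..<2 * a} E"
proof -
  have "e \<subseteq> {..<2 * a} \<and> card e = 2" if "e \<in> clique_edges a \<or> e \<in> cross_edges a" for e
    using that
  proof
    assume "e \<in> clique_edges a"
    moreover have "{..<a} \<subseteq> {..<2 * a}" "{a..<2 * a} \<subseteq> {..<2 * a}" by auto
    ultimately show ?thesis unfolding clique_edges_def mem_Collect_eq by (metis subset_trans)
  qed (auto simp: cross_edges_def)
  then show ?thesis
    using assms by (auto simp: simple_graph_def clique_pairs_def)
qed

lemma clique_pairs_clique:
  assumes "E \<in> clique_pairs a"
  shows "clique E {..<a}" "clique E {a..<2 * a}"
  using assms by (auto simp: clique_pairs_def clique_edges_def clique_def)

lemma clique_linked_in:
  assumes "clique E K" "u \<in> S \<inter> K" "v \<in> S \<inter> K"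
  shows "(u, v) \<in> linked_in E S"
  using assms by (cases "u = v") (auto simp: linked_in_iff clique_def)

text \<open>Each side of \<open>S\<close> is held together by its clique, so all that matters is
  whether \<open>E\<close> has an edge between the sides inside \<open>S\<close>. Both alternatives
  depend on \<open>a\<close> and \<open>S\<close> only, so an answer carries at most one bit about
  \<open>E\<close>.\<close>

lemma linked_in_clique_pairs:
  assumes E: "E \<in> clique_pairs a" and S: "S \<subseteq> {..<2 * a}"
  shows "linked_in E S = S \<times> S \<or>
    linked_in E S = {(u, v). u \<in> S \<and> v \<in> S \<and> (u < a \<longleftrightarrow> v < a)}"
proof (cases "\<exists>x\<in>S. \<exists>y\<in>S. {x, y} \<in> E \<and> x < a \<and> \<not> y < a")
  case True
  then obtain x y where xy: "x \<in> S" "y \<in> S" "{x, y} \<in> E" "x < a" "\<not> y < a" by blast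
  let ?R = "{(x, y). x \<in> S \<and> y \<in> S \<and> {x, y} \<in> E}"
  have y: "y \<in> {a..<2 * a}" using xy S by auto
  \<comment> \<open>The vertex \<open>x\<close> is a hub: its own side is reached through the left
    clique, the other side by crossing to \<open>y\<close> first.\<close>
  have from_x: "(x, u) \<in> ?R\<^sup>* \<and> (u, x) \<in> ?R\<^sup>*" if u: "u \<in> S" for u
  proof (cases "u < a")
    case True
    then show ?thesis
      using clique_linked_in[OF clique_pairs_clique(1)[OF E], of x S u]
        clique_linked_in[OF clique_pairs_clique(1)[OF E], of u S x] xy u
      by (simp add: linked_in_iff)
  next
    case False
    then have "u \<in> {a..<2 * a}" using u S by auto
    then have "(y, u) \<in> ?R\<^sup>*" "(u, y) \<in> ?R\<^sup>*"
      using clique_linked_in[OF clique_pairs_clique(2)[OF E], of y S u]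
        clique_linked_in[OF clique_pairs_clique(2)[OF E], of u S y] xy u y
      by (simp_all add: linked_in_iff)
    moreover have "(x, y) \<in> ?R" "(y, x) \<in> ?R"
      using xy by (auto simp: insert_commute)
    ultimately show ?thesis
      by (meson converse_rtrancl_into_rtrancl rtrancl_into_rtrancl)
  qed
  have "(u, v) \<in> linked_in E S" if "u \<in> S" "v \<in> S" for u v
    using that from_x rtrancl_trans[of u x ?R v] by (simp add: linked_in_iff)
  then have "linked_in E S = S \<times> S"
    by (auto simp: linked_in_def)
  then show ?thesis by blast
next
  case False
  \<comment> \<open>Without a crossing edge inside \<open>S\<close>, the side is invariant along
    every path.\<close>
  have same: "u < a \<longleftrightarrow> v < a" if "(u, v) \<in> linked_in E S" for u v
  proof -
    have "(u, v) \<in> {(x, y). x \<in> S \<and> y \<in> S \<and> {x, y} \<in> E}\<^sup>*"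
      using that by (simp add: linked_in_iff)
    then show ?thesis
    proof (induction rule: rtrancl_induct)
      case (step y z)
      then have "y \<in> S" "z \<in> S" "{y, z} \<in> E" "{z, y} \<in> E"
        by (auto simp: insert_commute)
      then show ?case using False step.IH by blast
    qed simp
  qed
  have "linked_in E S = {(u, v). u \<in> S \<and> v \<in> S \<and> (u < a \<longleftrightarrow> v < a)}"
  proof (intro set_eqI iffI; clarify)
    fix u v assume uv: "(u, v) \<in> linked_in E S"
    then show "u \<in> S \<and> v \<in> S \<and> (u < a \<longleftrightarrow> v < a)"
      using same[OF uv] by (simp add: linked_in_iff)
  next
    fix u v assume uv: "u \<in> S" "v \<in> S" "u < a \<longleftrightarrow> v < a"
    show "(u, v) \<in> linked_in E S"
    proof (cases "u < a")
      case True
      then show ?thesis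
        using uv by (intro clique_linked_in[OF clique_pairs_clique(1)[OF E]]) auto
    next
      case False
      then show ?thesis
        using uv S by (intro clique_linked_in[OF clique_pairs_clique(2)[OF E]]) auto
    qed
  qed
  then show ?thesis by blast
qed

section \<open>Counting solved instances\<close>

text \<open>Induction on the decision tree: an output is right for at most one graph, and a query
  sends \<open>\<G>\<close> into at most two of its subtrees, each with one query less to
  spend.\<close>

lemma card_solved_le:
  assumes fin: "finite \<G>"
    and two: "\<And>S. S \<subseteq> V \<Longrightarrow> \<exists>P Q. \<forall>E\<in>\<G>. cc E S = P \<or> cc E S = Q"
    and "queries_within V T"
  shows "card {E \<in> \<G>. result T (cc E) = E \<and> num_queries T (cc E) \<le> q} \<le> 2 ^ q"
  using assms(3)
proof (induction T arbitrary: q)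
  case (Output F)
  have "card {E \<in> \<G>. result (Output F) (cc E) = E \<and> num_queries (Output F) (cc E) \<le> q} \<le> card {F}"
    by (intro card_mono) auto
  also have "\<dots> \<le> 2 ^ q" by simp
  finally show ?case .
next
  case (Query S k)
  show ?case
  proof (cases q)
    \<comment> \<open>A tree that starts with a query never stays within a budget of zero, so the
      set is empty.\<close>
    case 0
    then show ?thesis by simp
  next
    case (Suc q')
    let ?C = "\<lambda>P. {E \<in> \<G>. result (k P) (cc E) = E \<and> num_queries (k P) (cc E) \<le> q'}"
    obtain P Q where PQ: "\<forall>E\<in>\<G>. cc E S = P \<or> cc E S = Q"
      using two[of S] Query.prems by auto
    have C: "card (?C R) \<le> 2 ^ q'" for R
      using Query.IH[of "k R" q'] Query.prems by simp
    have "{E \<in> \<G>. result (Query S k) (cc E) = E \<and> num_queries (Query S k) (cc E) \<le> q}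
        \<subseteq> ?C P \<union> ?C Q"
      using PQ Suc by auto
    then have "card {E \<in> \<G>. result (Query S k) (cc E) = E \<and> num_queries (Query S k) (cc E) \<le> q}
        \<le> card (?C P \<union> ?C Q)"
      using fin by (intro card_mono) auto
    also have "\<dots> \<le> card (?C P) + card (?C Q)"
      by (rule card_Un_le)
    also have "\<dots> \<le> 2 ^ q"
      using C[of P] C[of Q] Suc by simp
    finally show ?thesis .
  qed
qed

section \<open>Averaging over the random seeds\<close>

text \<open>The sum of the probabilities is the expected number of events that occur.\<close>

lemma (in prob_space) sum_prob_le_card:
  assumes "finite I" "\<And>i. i \<in> I \<Longrightarrow> {\<omega> \<in> space M. P i \<omega>} \<in> events"
    and "AE \<omega> in M. real (card {i \<in> I. P i \<omega>}) \<le> c"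
  shows "(\<Sum>i\<in>I. prob {\<omega> \<in> space M. P i \<omega>}) \<le> c"
proof -
  let ?S = "\<lambda>i. {\<omega> \<in> space M. P i \<omega>}"
  have int: "integrable M (indicator (?S i) :: _ \<Rightarrow> real)" if "i \<in> I" for i
    using assms(2)[OF that] by (simp add: emeasure_eq_measure)
  have "(\<Sum>i\<in>I. prob (?S i)) = (\<Sum>i\<in>I. \<integral>\<omega>. indicator (?S i) \<omega> \<partial>M)"
    using assms(2) by (intro sum.cong) auto
  also have "\<dots> = (\<integral>\<omega>. (\<Sum>i\<in>I. indicator (?S i) \<omega>) \<partial>M)"
    using int by (simp add: Bochner_Integration.integral_sum)
  also have "\<dots> \<le> (\<integral>\<omega>. c \<partial>M)"
  proof (intro integral_mono_AE)
    show "AE \<omega> in M. (\<Sum>i\<in>I. indicator (?S i) \<omega>) \<le> c"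
      using assms(3) AE_space
    proof eventually_elim
      case (elim \<omega>)
      have "(\<Sum>i\<in>I. indicator (?S i) \<omega> :: real) = (\<Sum>i\<in>I. if P i \<omega> then 1 else 0)"
        using elim by (intro sum.cong) (auto simp: indicator_def)
      also have "\<dots> = real (card {i \<in> I. P i \<omega>})"
        using assms(1) by (simp add: sum.If_cases Int_def)
      finally show ?case using elim by simp
    qed
  qed (use int in auto)
  also have "\<dots> = c" by (simp add: prob_space)
  finally show ?thesis .
qed

text \<open>If fewer than \<open>a\<^sup>2\<close> queries almost surely sufficed on every instance,
  almost every seed would solve at most half of the instances. But success probabilities above one
  half make the expected number of solved instances exceed half.\<close>

lemma clique_pairs_query_bound:
  assumes alg: "randomized_alg M A" and rec: "reconstructs M A"
  shows "\<exists>E\<in>clique_pairs a. \<not> (AE \<omega> in M (2 * a). num_queries (A (2 * a) \<omega>) (cc E) < a\<^sup>2)"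
proof (rule ccontr)
  let ?M = "M (2 * a)" and ?A = "A (2 * a)" and ?\<G> = "clique_pairs a"
  assume "\<not> ?thesis"
  then have less: "\<forall>E\<in>?\<G>. AE \<omega> in ?M. num_queries (?A \<omega>) (cc E) < a\<^sup>2" by blast
  interpret prob_space ?M using alg by (simp add: randomized_alg_def)
  have succ: "measure ?M {\<omega> \<in> space ?M. result (?A \<omega>) (cc E) = E} > 1 / 2" if "E \<in> ?\<G>" for E
    using rec clique_pairs_simple_graph[OF that] by (simp add: reconstructs_def)
  \<comment> \<open>A set that is not an event would have measure zero.\<close>
  have ev: "{\<omega> \<in> space ?M. result (?A \<omega>) (cc E) = E} \<in> events" if "E \<in> ?\<G>" for E
    using succ[OF that] measure_notin_sets by fastforce
  have ne: "?\<G> \<noteq> {}"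
    by (auto simp: clique_pairs_def)
  have two: "\<exists>P Q. \<forall>E\<in>?\<G>. cc E S = P \<or> cc E S = Q" if "S \<subseteq> {..<2 * a}" for S
  proof (intro exI ballI)
    fix E assume "E \<in> ?\<G>"
    then have "linked_in E S = S \<times> S \<or>
        linked_in E S = {(u, v). u \<in> S \<and> v \<in> S \<and> (u < a \<longleftrightarrow> v < a)}"
      by (rule linked_in_clique_pairs[OF _ that])
    then show "cc E S = S // (S \<times> S) \<or>
        cc E S = S // {(u, v). u \<in> S \<and> v \<in> S \<and> (u < a \<longleftrightarrow> v < a)}"
      unfolding cc_def by (elim disjE) simp_all
  qed
  \<comment> \<open>There are finitely many instances, so their exceptional null sets can be merged
    into one.\<close>
  have all: "AE \<omega> in ?M. \<forall>E\<in>?\<G>. num_queries (?A \<omega>) (cc E) < a\<^sup>2"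
    using less finite_clique_pairs by (simp add: AE_finite_all)
  \<comment> \<open>For \<open>a = 0\<close> the assumption would ask for fewer than zero queries.
    Positivity keeps \<open>a\<^sup>2 - 1\<close> from being truncated, so that
    \<open>2 ^ (a\<^sup>2 - 1)\<close> is exactly half the number of instances.\<close>
  have pos: "0 < a\<^sup>2"
  proof (rule ccontr)
    assume "\<not> 0 < a\<^sup>2"
    then have "AE \<omega> in ?M. False"
      using less ne by auto
    then show False by simp
  qed
  have "AE \<omega> in ?M. real (card {E \<in> ?\<G>. result (?A \<omega>) (cc E) = E}) \<le> 2 ^ (a\<^sup>2 - 1)"
    using all AE_space
  proof eventually_elim
    case (elim \<omega>)
    have "{E \<in> ?\<G>. result (?A \<omega>) (cc E) = E} =
        {E \<in> ?\<G>. result (?A \<omega>) (cc E) = E \<and> num_queries (?A \<omega>) (cc E) \<le> a\<^sup>2 - 1}"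
      using elim(1) by fastforce
    also have "card \<dots> \<le> 2 ^ (a\<^sup>2 - 1)"
      using alg elim(2) two
      by (intro card_solved_le[where V = "{..<2 * a}"])
        (auto simp: randomized_alg_def finite_clique_pairs)
    finally have "real (card {E \<in> ?\<G>. result (?A \<omega>) (cc E) = E}) \<le> real (2 ^ (a\<^sup>2 - 1))"
      by (simp only: of_nat_le_iff)
    then show ?case by simp
  qed
  then have "(\<Sum>E\<in>?\<G>. prob {\<omega> \<in> space ?M. result (?A \<omega>) (cc E) = E}) \<le> 2 ^ (a\<^sup>2 - 1)"
    using ev finite_clique_pairs by (intro sum_prob_le_card) auto
  moreover have "(\<Sum>E\<in>?\<G>. 1 / 2) < (\<Sum>E\<in>?\<G>. prob {\<omega> \<in> space ?M. result (?A \<omega>) (cc E) = E})"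
    using succ ne finite_clique_pairs by (intro sum_strict_mono) auto
  moreover have "(\<Sum>E\<in>?\<G>. 1 / 2 :: real) = 2 ^ (a\<^sup>2 - 1)"
    using pos by (simp add: card_clique_pairs power_diff)
  ultimately show False by simp
qed

section \<open>From the query bound to the asymptotic statement\<close>

text \<open>The lower bound pushes \<open>p\<close> beyond every threshold as \<open>a\<close>
  grows; the upper bound turns a small multiple of \<open>g\<close> into fewer than
  \<open>a\<^sup>2\<close> queries.\<close>

lemma not_uses_o_queries:
  assumes alg: "randomized_alg M A" and rec: "reconstructs M A"
    and lower: "\<And>a E. E \<in> clique_pairs a \<Longrightarrow> a - 1 \<le> p {..<2 * a} E"
    and upper: "\<And>a E. E \<in> clique_pairs a \<Longrightarrow> \<bar>g (p {..<2 * a} E)\<bar> \<le> (2 * real a)\<^sup>2"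
  shows "\<not> uses_o_queries M A p g"
proof
  assume "uses_o_queries M A p g"
  then obtain f N where f: "f \<in> o(g)"
    and N: "\<forall>n E. simple_graph {..<n} E \<and> N \<le> p {..<n} E \<longrightarrow>
      (AE \<omega> in M n. real (num_queries (A n \<omega>) (cc E)) \<le> f (p {..<n} E))"
    unfolding uses_o_queries_def by blast
  \<comment> \<open>Since \<open>g\<close> is at most \<open>4 * a\<^sup>2\<close> on these
    instances, any factor below \<open>1 / 4\<close> would do; \<open>1 / 8\<close> leaves
    \<open>a\<^sup>2 / 2\<close>.\<close>
  have "\<forall>\<^sub>F x in sequentially. norm (f x) \<le> 1 / 8 * norm (g x)"
    using landau_o.smallD[OF f, of "1 / 8"] by simp
  then obtain N' where N': "\<And>x. N' \<le> x \<Longrightarrow> \<bar>f x\<bar> \<le> 1 / 8 * \<bar>g x\<bar>"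
    by (auto simp: eventually_sequentially)
  \<comment> \<open>The successor makes \<open>a - 1\<close> reach both thresholds and keeps
    \<open>a\<close> positive.\<close>
  define a where "a = Suc (max N N')"
  then have "0 < a" by simp
  obtain E where E: "E \<in> clique_pairs a"
    and many: "\<not> (AE \<omega> in M (2 * a). num_queries (A (2 * a) \<omega>) (cc E) < a\<^sup>2)"
    using clique_pairs_query_bound[OF alg rec] by blast
  let ?p = "p {..<2 * a} E"
  have p: "N \<le> ?p" "N' \<le> ?p"
    using lower[OF E] by (auto simp: a_def)
  have "f ?p \<le> 1 / 8 * (2 * real a)\<^sup>2"
    using N'[OF p(2)] upper[OF E] by linarith
  also have "\<dots> < real (a\<^sup>2)"
    using \<open>0 < a\<close> by (simp add: power_mult_distrib)
  finally have small: "f ?p < real (a\<^sup>2)" .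
  have "AE \<omega> in M (2 * a). real (num_queries (A (2 * a) \<omega>) (cc E)) \<le> f ?p"
    using N clique_pairs_simple_graph[OF E] p(1) by blast
  then have "AE \<omega> in M (2 * a). num_queries (A (2 * a) \<omega>) (cc E) < a\<^sup>2"
  proof eventually_elim
    case (elim \<omega>)
    then have "real (num_queries (A (2 * a) \<omega>) (cc E)) < real (a\<^sup>2)"
      using small by linarith
    then show ?case by (simp only: of_nat_less_iff)
  qed
  then show False using many by blast
qed

theorem theorem12:
  fixes M :: "nat \<Rightarrow> 'w measure" and A :: "nat \<Rightarrow> 'w \<Rightarrow> nat cc_alg"
  assumes "randomized_alg M A" and "reconstructs M A"
  shows "\<not> uses_o_queries M A num_edges (\<lambda>m. real m) \<and>
         \<not> uses_o_queries M A treewidth (\<lambda>k. (real k)\<^sup>2) \<and>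
         \<not> uses_o_queries M A max_degree (\<lambda>\<Delta>. (real \<Delta>)\<^sup>2) \<and>
         \<not> uses_o_queries M A degeneracy (\<lambda>d. (real d)\<^sup>2)"
proof -
  have sub: "{..<a} \<subseteq> {..<2 * a}" for a :: nat by auto
  have squared: "\<bar>(real x)\<^sup>2\<bar> \<le> (2 * real a)\<^sup>2" if "x \<le> card {..<2 * a}" for x a
  proof -
    have "real x \<le> 2 * real a" using that by simp
    then have "(real x)\<^sup>2 \<le> (2 * real a)\<^sup>2" by (intro power_mono) auto
    then show ?thesis by simp
  qed
  have linear: "\<bar>real x\<bar> \<le> (2 * real a)\<^sup>2" if "x \<le> (card {..<2 * a})\<^sup>2" for x a
  proof -
    have "real x \<le> real ((2 * a)\<^sup>2)" using that by (simp only: of_nat_le_iff card_lessThan)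
    then show ?thesis by simp
  qed
  show ?thesis
  proof (intro conjI; rule not_uses_o_queries[OF assms])
    \<comment> \<open>The lower bounds come from the left clique alone, the upper bounds from the
      number \<open>2 * a\<close> of vertices.\<close>
    fix a E assume E: "E \<in> clique_pairs a"
    note simple = clique_pairs_simple_graph[OF E] and cl = clique_pairs_clique(1)[OF E]
    show "a - 1 \<le> num_edges {..<2 * a} E"
      using clique_card_le_num_edges[OF simple cl] by simp
    show "a - 1 \<le> treewidth {..<2 * a} E"
      using clique_card_le_treewidth[OF simple cl sub] by simp
    show "a - 1 \<le> max_degree {..<2 * a} E"
      using clique_card_le_max_degree[OF simple cl sub] by simp
    show "a - 1 \<le> degeneracy {..<2 * a} E"
      using clique_card_le_degeneracy[OF simple cl sub] by simp
    show "\<bar>real (num_edges {..<2 * a} E)\<bar> \<le> (2 * real a)\<^sup>2"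
      by (rule linear[OF num_edges_le_card_vertices_squared[OF simple]])
    show "\<bar>(real (treewidth {..<2 * a} E))\<^sup>2\<bar> \<le> (2 * real a)\<^sup>2"
      by (rule squared[OF treewidth_le_card_vertices[OF simple]])
    show "\<bar>(real (max_degree {..<2 * a} E))\<^sup>2\<bar> \<le> (2 * real a)\<^sup>2"
      by (rule squared[OF max_degree_le_card_vertices[OF simple]])
    show "\<bar>(real (degeneracy {..<2 * a} E))\<^sup>2\<bar> \<le> (2 * real a)\<^sup>2"
      by (rule squared[OF degeneracy_le_card_vertices[OF simple]])
  qed
qed

end
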